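(* Let $q$ be a prime power, $n\ge 2$, $V=\mathbb{F}_q^n$, and let $1\le k\le n-1$ with $k\neq n/2$. Then $1/Z_c(X_0^{[k]}(V),u)$ is a product of factors of the form $(1-q^su^2)$ with $s\in\mathbb{Z}_{\ge0}$.
   Context: $X_0(V)$ is the undirected graph (viewed as a digraph with edges in both directions) whose vertices $x_W$ are the nonzero proper subspaces $W$ of $V$, with an edge between $x_{W_1}$ and $x_{W_2}$ iff $W_1\oplus W_2=V$. For $1\le k\le n-1$, $X_0^{[k]}(V)$ is the induced subgraph of $X_0(V)$ on the vertices $x_W$ with $\dim W\in\{k,n-k\}$. For a finite digraph $X$, $N_c(X,l)$ is the number of closed walks (sequences $(v_0,\dots,v_l)$ with each $(v_i,v_{i+1})$ an edge and $v_l=v_0$) of length $l$, and $Z_c(X,u)=\exp\left(\sum_{l\ge1}\frac{N_c(X,l)}{l}u^l\right)$. *)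

theory Defs
  imports
    "HOL-Analysis.Cartesian_Space"
    "HOL-Computational_Algebra.Formal_Power_Series"
    "HOL-Number_Theory.Prime_Powers"
    "Graph_Theory.Graph_Theory"
begin

(* Walks are vertex sequences (v_0, ..., v_l), so the count is meant for digraphs
   without parallel arcs.  It is 0 by convention if there are infinitely many. *)
definition closed_walk_count :: "('v, 'e) pre_digraph \<Rightarrow> nat \<Rightarrow> nat" where
  "closed_walk_count G l = card {p. vwalk p G \<and> vwalk_length p = l \<and> hd p = last p}"

(* The constant coefficient of the inner series is x / 0 = 0, so the sum starts at
   l = 1 and composing it with the exponential series is legitimate. *)
definition cycle_zeta :: "('v, 'e) pre_digraph \<Rightarrow> rat fps" where
  "cycle_zeta G =
     fps_exp 1 oo Abs_fps (\<lambda>l. of_nat (closed_walk_count G l) / of_nat l)"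

(* The vertex x_W is represented by the subspace W itself. *)
definition complement_graph :: "(('a::field)^'n) set pair_pre_digraph" where
  "complement_graph =
     (let vs = {W. vec.subspace W \<and> W \<noteq> {0} \<and> W \<noteq> UNIV}
      in \<lparr> pverts = vs,
           parcs = {(W1, W2). W1 \<in> vs \<and> W2 \<in> vs \<and>
                      W1 \<inter> W2 = {0} \<and> {x + y | x y. x \<in> W1 \<and> y \<in> W2} = UNIV} \<rparr>)"

definition complement_graph_dim ::
    "nat \<Rightarrow> ((('a::field)^'n) set, ('a^'n) set \<times> ('a^'n) set) pre_digraph" where
  "complement_graph_dim k =
     with_proj complement_graph \<restriction>
       {W \<in> pverts complement_graph. vec.dim W = k \<or> vec.dim W = CARD('n) - k}"

end

theory Submission
  imports Defs "Jordan_Normal_Form.Schur_Decomposition"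
begin

text \<open>
  With \<open>m = n - k > k\<close>, the graph is bipartite between the subspaces of dimension \<open>k\<close> and \<open>m\<close>.
  Let \<open>M\<close> be its biadjacency matrix and \<open>N = M M\<^sup>T\<close>. There are no closed walks of odd
  length, and \<open>2 tr(N\<^sup>j)\<close> of length \<open>2 j > 0\<close>, so \<open>1 / Z\<close> is the product of \<open>1 - \<lambda> u\<^sup>2\<close> over the
  eigenvalues \<open>\<lambda>\<close> of \<open>N\<close>. To see that \<open>\<lambda>\<close> is a power of \<open>q\<close>, take an eigenvector \<open>f\<close>
  and let \<open>R f U\<close> be the sum of \<open>f W\<close> over \<open>W \<supseteq> U\<close>. If \<open>j\<close> is the least dimension in which \<open>R f\<close>
  does not vanish, then Moebius inversion over the subspaces of \<open>U\<close> and the count of complements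
  of a subspace give \<open>R (N f) U = q ^ s R f U\<close> for all \<open>U\<close> of dimension \<open>j\<close>, where
  \<open>s = m (k - j) + k (m - j) + j (j - 1)\<close>. No multiplicities are needed.
\<close>

section \<open>Counting subspaces over a finite field\<close>

text \<open>Adjoining a vector \<open>b\<close> outside a span multiplies its size by
  \<open>CARD('a)\<close>, because \<open>(c, x) \<mapsto> c *s b + x\<close> is a bijection onto
  the new span. The general case follows by taking a basis.\<close>

lemma card_subspace:
  fixes W :: "('a::{field,finite}^'n) set"
  assumes "vec.subspace W"
  shows "card W = CARD('a) ^ vec.dim W"
proof -
  have span: "card (vec.span B) = CARD('a) ^ card B"
    if "finite B" "vec.independent B" for B :: "('a^'n) set"
    using that
  proof (induction B rule: finite_induct)
    case empty
    show ?case by (simp add: vec.span_empty)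
  next
    case (insert b B)
    then have b: "b \<notin> vec.span B" and ind: "vec.independent B"
      by (simp_all add: vec.independent_insert)
    have eq: "vec.span (insert b B) = (\<lambda>(c, x). c *s b + x) ` (UNIV \<times> vec.span B)" (is "_ = ?f ` _")
    proof (intro equalityI subsetI)
      fix x assume "x \<in> vec.span (insert b B)"
      then obtain c where "x - c *s b \<in> vec.span B" by (auto simp: vec.span_breakdown_eq)
      then have "x = ?f (c, x - c *s b)" "(c, x - c *s b) \<in> UNIV \<times> vec.span B" by auto
      then show "x \<in> ?f ` (UNIV \<times> vec.span B)" by blast
    next
      fix x assume "x \<in> ?f ` (UNIV \<times> vec.span B)"
      then obtain c y where "x = c *s b + y" "y \<in> vec.span B" by auto
      then have "x - c *s b \<in> vec.span B" by simp
      then show "x \<in> vec.span (insert b B)" by (auto simp: vec.span_breakdown_eq)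
    qed
    have "inj_on ?f (UNIV \<times> vec.span B)"
    proof (rule inj_onI, clarify)
      fix c d x y
      assume xy: "x \<in> vec.span B" "y \<in> vec.span B" and e: "c *s b + x = d *s b + y"
      then have "(c - d) *s b = y - x" by (simp add: algebra_simps vec.scale_left_diff_distrib)
      then have m: "(c - d) *s b \<in> vec.span B" using xy by (simp add: vec.span_diff)
      have "c = d"
      proof (rule ccontr)
        assume "c \<noteq> d"
        then have "b = inverse (c - d) *s ((c - d) *s b)" by (simp add: vector_smult_assoc)
        then show False using vec.span_scale[OF m] b by metis
      qed
      then show "c = d \<and> x = y" using e by simp
    qed
    then show ?case
      using insert ind by (simp add: eq card_image card_cartesian_product)
  qed
  obtain B where "B \<subseteq> W" "vec.independent B" "W \<subseteq> vec.span B" "card B = vec.dim W"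
    using vec.basis_exists by blast
  then show ?thesis
    using span[of B] vec.span_subspace[OF _ _ assms] by (metis finite)
qed

lemma dim_span_insert:
  fixes U :: "('a::field^'n) set"
  assumes "vec.subspace U" "b \<notin> U"
  shows "vec.dim (vec.span (insert b U)) = Suc (vec.dim U)"
  using assms by (simp add: vec.dim_insert vec.span_eq_iff[THEN iffD2])

lemma dim_sums_disjoint:
  fixes U :: "('a::field^'n) set"
  assumes "vec.subspace U" "vec.subspace X" "U \<inter> X = {0}"
  shows "vec.dim {x + y | x y. x \<in> U \<and> y \<in> X} = vec.dim U + vec.dim X"
  using vec.dim_sums_Int[OF assms(1,2)] assms(3) by simp

text \<open>The dimensions add up in a direct sum, and a subspace of \<open>B\<close> of full
  dimension is \<open>B\<close>. This replaces the spanning condition on complements by a dimension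
  count.\<close>

lemma complement_sums_iff:
  fixes U :: "('a::field^'n) set"
  assumes "vec.subspace U" "vec.subspace X" "vec.subspace B" "U \<subseteq> B" "X \<subseteq> B" "U \<inter> X = {0}"
  shows "{x + y | x y. x \<in> U \<and> y \<in> X} = B \<longleftrightarrow> vec.dim U + vec.dim X = vec.dim B"
proof -
  have "{x + y | x y. x \<in> U \<and> y \<in> X} \<subseteq> B"
    using assms by (auto intro: vec.subspace_add)
  then show ?thesis
    using vec.subspace_dim_equal[of "{x + y | x y. x \<in> U \<and> y \<in> X}" B]
      vec.subspace_sums[OF assms(1,2)] dim_sums_disjoint[OF assms(1,2,6)] assms(3)
    by (metis (no_types, lifting) order_refl)
qed

text \<open>If \<open>b \<notin> U + X\<close>, a complement \<open>W\<close> of \<open>X\<close> meets the coset \<open>b + X\<close> in exactly one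
  point, so the complements containing \<open>U\<close> are partitioned according to that point.\<close>

lemma card_complements_containing:
  fixes B U X :: "('a::{field,finite}^'n) set"
  assumes "vec.subspace B" "vec.subspace U" "vec.subspace X" "U \<subseteq> B" "X \<subseteq> B" "U \<inter> X = {0}"
  shows "card {W. vec.subspace W \<and> U \<subseteq> W \<and> W \<subseteq> B \<and> W \<inter> X = {0} \<and> vec.dim W + vec.dim X = vec.dim B}
    = card X ^ (vec.dim B - vec.dim X - vec.dim U)"
  using assms(2,4,6)
proof (induction "vec.dim B - vec.dim X - vec.dim U" arbitrary: U)
  case (0 U)
  \<comment> \<open>The truncated subtraction gives only
    \<open>vec.dim B \<le> vec.dim U + vec.dim X\<close>. The reverse inequality holds because the
    direct sum of \<open>U\<close> and \<open>X\<close> lies in \<open>B\<close>.\<close>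
  have "{x + y | x y. x \<in> U \<and> y \<in> X} \<subseteq> B"
    using 0 assms by (auto intro: vec.subspace_add)
  then have "vec.dim U + vec.dim X \<le> vec.dim B"
    using dim_sums_disjoint[OF 0(2) assms(3) 0(4)] vec.dim_subset[of "{x + y | x y. x \<in> U \<and> y \<in> X}" B] by simp
  with 0 have d: "vec.dim U + vec.dim X = vec.dim B" by simp
  have "W = U" if "vec.subspace W" "U \<subseteq> W" "vec.dim W + vec.dim X = vec.dim B" for W
    using vec.subspace_dim_equal[of U W] that 0 d by simp
  then have "{W. vec.subspace W \<and> U \<subseteq> W \<and> W \<subseteq> B \<and> W \<inter> X = {0} \<and> vec.dim W + vec.dim X = vec.dim B} = {U}"
    using 0 d by auto
  then show ?case using 0 by (simp only: card.insert card.empty) simp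
next
  case (Suc m U)
  let ?C = "\<lambda>U. {W. vec.subspace W \<and> U \<subseteq> W \<and> W \<subseteq> B \<and> W \<inter> X = {0} \<and> vec.dim W + vec.dim X = vec.dim B}"
  let ?S = "{x + y | x y. x \<in> U \<and> y \<in> X}"
  have "?S \<noteq> B"
    using complement_sums_iff[of U X B] Suc assms by linarith
  moreover have "?S \<subseteq> B"
    using Suc assms by (auto intro: vec.subspace_add)
  ultimately obtain b where b: "b \<in> B" "b \<notin> ?S" by blast
  let ?U = "\<lambda>x. vec.span (insert (b - x) U)"
  have bU: "b - x \<notin> U" if "x \<in> X" for x
  proof
    assume "b - x \<in> U"
    then have "(b - x) + x \<in> ?S" using that by blast
    then show False using b by simp
  qed
  have sub: "?U x \<subseteq> W \<longleftrightarrow> b - x \<in> W \<and> U \<subseteq> W" if "vec.subspace W" for x W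
    using vec.span_minimal[of "insert (b - x) U" W] vec.span_superset[of "insert (b - x) U"] that by auto
  have part: "?C U = (\<Union>x\<in>X. ?C (?U x))"
  proof (intro equalityI subsetI)
    fix W assume W: "W \<in> ?C U"
    then have "b \<in> {x + y | x y. x \<in> W \<and> y \<in> X}"
      using complement_sums_iff[of W X B] assms b by auto
    then obtain w x where wx: "b = w + x" "w \<in> W" "x \<in> X" by auto
    then have "b - x \<in> W" by simp
    then show "W \<in> (\<Union>x\<in>X. ?C (?U x))" using W wx(3) sub[of W x] by blast
  qed (auto simp: sub)
  have disj: "?C (?U x) \<inter> ?C (?U y) = {}" if xy: "x \<in> X" "y \<in> X" "x \<noteq> y" for x y
  proof (rule ccontr)
    assume "?C (?U x) \<inter> ?C (?U y) \<noteq> {}"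
    then obtain W where W: "vec.subspace W" "W \<inter> X = {0}" "b - x \<in> W" "b - y \<in> W"
      by (auto simp: sub)
    have "(b - x) - (b - y) \<in> W" by (rule vec.subspace_diff[OF W(1,3,4)])
    then have "y - x \<in> W \<inter> X" using vec.subspace_diff[OF assms(3) xy(2,1)] by simp
    then have "y - x = 0" unfolding W(2) by simp
    then show False using xy by simp
  qed
  have card: "card (?C (?U x)) = card X ^ m" if x: "x \<in> X" for x
  proof -
    have "?U x \<inter> X = {0}"
    proof (intro equalityI subsetI)
      fix y assume "y \<in> ?U x \<inter> X"
      then obtain c where c: "y - c *s (b - x) \<in> vec.span U" and y: "y \<in> X"
        by (auto simp: vec.span_breakdown_eq)
      then have cU: "y - c *s (b - x) \<in> U" using Suc vec.span_eq_iff by metis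
      \<comment> \<open>Otherwise the relation could be solved for \<open>b\<close>, which would
        place \<open>b\<close> in \<open>?S\<close>.\<close>
      have "c = 0"
      proof (rule ccontr)
        assume "c \<noteq> 0"
        have "(- inverse c) *s (y - c *s (b - x)) \<in> U" "x + inverse c *s y \<in> X"
          using cU Suc x y assms(3) by (auto intro!: vec.subspace_scale vec.subspace_add vec.subspace_neg)
        moreover have "b = (- inverse c) *s (y - c *s (b - x)) + (x + inverse c *s y)"
          using \<open>c \<noteq> 0\<close> by (simp add: vec.scale_right_diff_distrib vector_smult_assoc)
        ultimately have "b \<in> ?S" by blast
        then show False using b by simp
      qed
      then show "y \<in> {0}" using cU y Suc by auto
    qed (use assms(3) vec.subspace_0 in auto)
    moreover have "?U x \<subseteq> B"
      using b x Suc assms by (intro vec.span_minimal) (auto intro: vec.subspace_diff)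
    moreover have dim: "vec.dim (?U x) = Suc (vec.dim U)"
      using dim_span_insert[of U "b - x"] bU[OF x] Suc by simp
    moreover have "m = vec.dim B - vec.dim X - vec.dim (?U x)"
      using Suc(2) unfolding dim by simp
    ultimately show ?thesis
      using Suc(1)[of "?U x"] by (metis vec.subspace_span)
  qed
  have "card (?C U) = (\<Sum>x\<in>X. card (?C (?U x)))"
    unfolding part by (rule card_UN_disjoint) (use disj in auto)
  also have "\<dots> = card X ^ Suc m" using card by simp
  finally show ?case using Suc(2) by simp
qed

section \<open>Moebius inversion and the eigenvalues\<close>

text \<open>The Moebius function value \<mu>(0, T) in the lattice of subspaces over a field with
  \<open>q\<close> elements, for \<open>T\<close> of dimension \<open>d\<close>.\<close>

definition mobius_coeff :: "nat \<Rightarrow> nat \<Rightarrow> 'c::comm_ring_1" where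
  "mobius_coeff q d = (- 1) ^ d * of_nat q ^ (d choose 2)"

lemma mobius_coeff_0 [simp]: "mobius_coeff q 0 = 1"
  by (simp add: mobius_coeff_def numeral_2_eq_2)

lemma mobius_coeff_Suc: "mobius_coeff q (Suc d) = - (of_nat q ^ d * mobius_coeff q d)"
  by (simp add: mobius_coeff_def numeral_2_eq_2 power_add)

text \<open>The sign cancels. This is the source of the summand \<open>j (j - 1)\<close> in the
  exponent of the eigenvalue.\<close>

lemma mobius_coeff_square: "mobius_coeff q d * mobius_coeff q d = of_nat q ^ (2 * (d choose 2))"
  by (simp add: mobius_coeff_def mult_2 power_add algebra_simps flip: power_mult_distrib)

text \<open>For a line \<open>L \<subseteq> Y\<close>, the subspaces \<open>T\<close> not containing \<open>L\<close> are grouped by \<open>S = T + L\<close>;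
  there are \<open>q ^ (dim S - 1)\<close> of them in each group, and they cancel the term of \<open>S\<close>.\<close>

lemma sum_mobius_coeff:
  fixes Y :: "('a::{field,finite}^'n) set"
  assumes Y: "vec.subspace Y"
  shows "(\<Sum>T | vec.subspace T \<and> T \<subseteq> Y. mobius_coeff CARD('a) (vec.dim T)) = of_bool (Y = {0})"
proof (cases "Y = {0}")
  case True
  then have "{T. vec.subspace T \<and> T \<subseteq> Y} = {{0}}"
    using vec.subspace_0 by auto
  then show ?thesis using True by simp
next
  case False
  then obtain l where l: "l \<in> Y" "l \<noteq> 0" using Y vec.subspace_0 by blast
  define L where "L = vec.span {l}"
  have L: "vec.subspace L" "vec.dim L = 1" "l \<in> L"
    using l by (simp_all add: L_def vec.span_base)
  have LS: "L \<subseteq> S" if "vec.subspace S" "l \<in> S" for S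
    using that by (simp add: L_def vec.span_minimal)
  have Lsmall: "S \<inter> L = {0}" if S: "vec.subspace S" "l \<notin> S" for S
  proof -
    have "x = 0" if x: "x \<in> S" "x \<in> L" for x
    proof (rule ccontr)
      assume "x \<noteq> 0"
      obtain c where c: "x = c *s l" using x by (auto simp: L_def vec.span_singleton)
      then have "l = inverse c *s x" using \<open>x \<noteq> 0\<close> by (auto simp: vector_smult_assoc)
      then show False using S x vec.subspace_scale by metis
    qed
    then show ?thesis using S L vec.subspace_0 by auto
  qed
  let ?S = "{S. vec.subspace S \<and> S \<subseteq> Y \<and> l \<in> S}" and ?T = "{T. vec.subspace T \<and> T \<subseteq> Y \<and> l \<notin> T}"
  let ?g = "\<lambda>T. vec.span (insert l T)" and ?\<mu> = "\<lambda>T. mobius_coeff CARD('a) (vec.dim T)"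
  have group: "(\<Sum>T | T \<in> ?T \<and> ?g T = S. ?\<mu> T) = - ?\<mu> S" if S: "S \<in> ?S" for S
  proof -
    have dim_S: "vec.dim S \<noteq> 0" using S l vec.dim_eq_0[of S] by auto
    \<comment> \<open>A subspace meets the line \<open>L\<close> trivially exactly when it omits
      \<open>l\<close>, so the group of \<open>S\<close> consists of the complements of
      \<open>L\<close> in \<open>S\<close>, which are already counted.\<close>
    have "{T. T \<in> ?T \<and> ?g T = S} =
      {T. vec.subspace T \<and> {0} \<subseteq> T \<and> T \<subseteq> S \<and> T \<inter> L = {0} \<and> vec.dim T + vec.dim L = vec.dim S}" (is "?A = ?B")
    proof (intro equalityI subsetI)
      fix T assume T: "T \<in> ?A"
      then have "T \<subseteq> S" using vec.span_superset[of "insert l T"] by auto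
      then show "T \<in> ?B" using T Lsmall[of T] dim_span_insert[of T l] L vec.subspace_0[of T] by auto
    next
      fix T assume T: "T \<in> ?B"
      then have lT: "l \<notin> T" using L l by auto
      then have "vec.dim (?g T) = vec.dim S" using T dim_span_insert[of T l] L by auto
      moreover have "?g T \<subseteq> S" using T S by (intro vec.span_minimal) auto
      ultimately have "?g T = S" using S by (intro vec.subspace_dim_equal) auto
      then show "T \<in> ?A" using T S lT by auto
    qed
    have "card ?A = card L ^ (vec.dim S - vec.dim L - vec.dim {0 :: 'a^'n})"
      unfolding \<open>?A = ?B\<close> using S L(1) LS
      by (intro card_complements_containing) (auto simp: vec.subspace_0)
    then have A: "card ?A = CARD('a) ^ (vec.dim S - 1)"
      using card_subspace[OF L(1)] L(2) by simp
    have dim: "vec.dim T = vec.dim S - 1" if "T \<in> ?A" for T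
    proof -
      have "T \<in> ?B" using that \<open>?A = ?B\<close> by (simp only:)
      then show ?thesis using L(2) by (simp only: mem_Collect_eq) linarith
    qed
    have "(\<Sum>T | T \<in> ?T \<and> ?g T = S. ?\<mu> T) = (\<Sum>T | T \<in> ?T \<and> ?g T = S. mobius_coeff CARD('a) (vec.dim S - 1))"
      by (rule sum.cong[OF refl]) (use dim in auto)
    also have "\<dots> = - ?\<mu> S"
      using A dim_S by (cases "vec.dim S") (simp_all add: mobius_coeff_Suc)
    finally show ?thesis .
  qed
  have "{T. vec.subspace T \<and> T \<subseteq> Y} = ?S \<union> ?T" by auto
  then have "(\<Sum>T | vec.subspace T \<and> T \<subseteq> Y. ?\<mu> T) = sum ?\<mu> ?S + sum ?\<mu> ?T"
    by (simp only:) (rule sum.union_disjoint; auto)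
  also have "sum ?\<mu> ?T = (\<Sum>S\<in>?S. \<Sum>T | T \<in> ?T \<and> ?g T = S. ?\<mu> T)"
    by (rule sum.group[symmetric]) (use l Y in \<open>auto simp: vec.span_base vec.span_minimal subset_iff[symmetric]\<close>,
        metis (no_types, lifting) insert_subset subsetD vec.span_minimal)
  also have "\<dots> = - sum ?\<mu> ?S"
    by (simp only: group sum_negf cong: sum.cong)
  finally show ?thesis using False by simp
qed

section \<open>Sums over subspaces of a fixed dimension\<close>

definition grassmannian :: "nat \<Rightarrow> ('a::field^'n) set set" where
  "grassmannian d = {W. vec.subspace W \<and> vec.dim W = d}"

text \<open>If \<open>d\<close> and the dimension of \<open>U\<close> add up to that of the whole
  space, this sums \<open>f\<close> over the complements of \<open>U\<close>, as the adjacency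
  operator does. Other dimensions of \<open>U\<close> occur in the Moebius argument.\<close>

definition disjoint_sum :: "nat \<Rightarrow> (('a::field^'n) set \<Rightarrow> 'c::comm_ring_1) \<Rightarrow> ('a^'n) set \<Rightarrow> 'c" where
  "disjoint_sum d f U = (\<Sum>W | W \<in> grassmannian d \<and> W \<inter> U = {0}. f W)"

text \<open>The operator \<open>R\<close> of the introduction, with the dimension \<open>d\<close>
  of the summation range made explicit.\<close>

definition superspace_sum :: "nat \<Rightarrow> (('a::field^'n) set \<Rightarrow> 'c::comm_ring_1) \<Rightarrow> ('a^'n) set \<Rightarrow> 'c" where
  "superspace_sum d f U = (\<Sum>W | W \<in> grassmannian d \<and> U \<subseteq> W. f W)"

text \<open>By \<open>sum_mobius_coeff\<close> the indicator of \<open>W \<inter> U = {0}\<close> is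
  a sum of Moebius coefficients over the subspaces \<open>T\<close> of \<open>W \<inter> U\<close>.
  Exchanging the sums collects, for each \<open>T \<subseteq> U\<close>, the \<open>W\<close> that
  contain \<open>T\<close>.\<close>

lemma disjoint_sum_mobius:
  fixes U :: "('a::{field,finite}^'n) set"
  assumes "vec.subspace U"
  shows "disjoint_sum d f U =
    (\<Sum>T | vec.subspace T \<and> T \<subseteq> U. mobius_coeff CARD('a) (vec.dim T) * superspace_sum d f T)"
proof -
  let ?\<mu> = "\<lambda>T. mobius_coeff CARD('a) (vec.dim T) :: 'b"
  have "disjoint_sum d f U = (\<Sum>W\<in>grassmannian d. of_bool (W \<inter> U = {0}) * f W)"
    unfolding disjoint_sum_def by (rule sum.mono_neutral_cong_left) auto
  also have "\<dots> = (\<Sum>W\<in>grassmannian d. (\<Sum>T | vec.subspace T \<and> T \<subseteq> W \<inter> U. ?\<mu> T) * f W)"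
  proof (rule sum.cong[OF refl])
    fix W :: "('a^'n) set" assume "W \<in> grassmannian d"
    then have "vec.subspace (W \<inter> U)"
      using assms by (simp add: grassmannian_def vec.subspace_inter)
    then show "of_bool (W \<inter> U = {0}) * f W = (\<Sum>T | vec.subspace T \<and> T \<subseteq> W \<inter> U. ?\<mu> T) * f W"
      by (simp only: sum_mobius_coeff)
  qed
  also have "\<dots> = (\<Sum>W\<in>grassmannian d. \<Sum>T | vec.subspace T \<and> T \<subseteq> U. of_bool (T \<subseteq> W) * (?\<mu> T * f W))"
    unfolding sum_distrib_right by (intro sum.cong[OF refl] sum.mono_neutral_cong_left) auto
  also have "\<dots> = (\<Sum>T | vec.subspace T \<and> T \<subseteq> U. \<Sum>W\<in>grassmannian d. of_bool (T \<subseteq> W) * (?\<mu> T * f W))"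
    by (rule sum.swap)
  also have "\<dots> = (\<Sum>T | vec.subspace T \<and> T \<subseteq> U. ?\<mu> T * superspace_sum d f T)"
    unfolding superspace_sum_def sum_distrib_left
    by (intro sum.cong[OF refl] sum.mono_neutral_cong_right) auto
  finally show ?thesis .
qed

text \<open>After exchanging the sums, \<open>f X\<close> is weighted by the number of complements
  of \<open>X\<close> that contain \<open>U\<close>. There are none unless \<open>X\<close> meets
  \<open>U\<close> trivially, and otherwise the number depends only on the dimensions.\<close>

lemma superspace_sum_disjoint_sum:
  fixes U :: "('a::{field,finite}^'n) set"
  assumes U: "vec.subspace U" and dim: "vec.dim U \<le> k" and n: "k + m = CARD('n)"
  shows "superspace_sum k (disjoint_sum m f) U = of_nat CARD('a) ^ (m * (k - vec.dim U)) * disjoint_sum m f U"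
proof -
  have count: "card {W \<in> grassmannian k. U \<subseteq> W \<and> X \<inter> W = {0}} =
      of_bool (X \<inter> U = {0}) * CARD('a) ^ (m * (k - vec.dim U))" if X: "X \<in> grassmannian m" for X
  proof (cases "X \<inter> U = {0}")
    case True
    have X': "vec.subspace X" "vec.dim X = m" using X by (simp_all add: grassmannian_def)
    have "{W \<in> grassmannian k. U \<subseteq> W \<and> X \<inter> W = {0}} =
        {W. vec.subspace W \<and> U \<subseteq> W \<and> W \<subseteq> UNIV \<and> W \<inter> X = {0} \<and> vec.dim W + vec.dim X = vec.dim (UNIV :: ('a^'n) set)}"
      unfolding grassmannian_def vec_dim_card X' n[symmetric] by (auto simp: Int_commute)
    also have "card \<dots> = card X ^ (vec.dim (UNIV :: ('a^'n) set) - vec.dim X - vec.dim U)"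
      using X' U True by (intro card_complements_containing) auto
    also have "\<dots> = CARD('a) ^ (m * (k - vec.dim U))"
    proof -
      have "CARD('n) - m - vec.dim U = k - vec.dim U" using n by simp
      then show ?thesis unfolding vec_dim_card card_subspace[OF X'(1)] X'(2) by (simp add: power_mult)
    qed
    finally show ?thesis using True by simp
  next
    case False
    have "X \<inter> W \<noteq> {0}" if "U \<subseteq> W" for W
      using False that X U vec.subspace_0[of X] vec.subspace_0[of U] by (auto simp: grassmannian_def)
    then have "{W \<in> grassmannian k. U \<subseteq> W \<and> X \<inter> W = {0}} = {}" by auto
    then show ?thesis using False by (simp only:) simp
  qed
  have "superspace_sum k (disjoint_sum m f) U =
      (\<Sum>W | W \<in> grassmannian k \<and> U \<subseteq> W. \<Sum>X\<in>grassmannian m. of_bool (X \<inter> W = {0}) * f X)"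
    unfolding superspace_sum_def disjoint_sum_def
    by (intro sum.cong[OF refl] sum.mono_neutral_cong_left) auto
  also have "\<dots> = (\<Sum>X\<in>grassmannian m. \<Sum>W | W \<in> grassmannian k \<and> U \<subseteq> W. of_bool (X \<inter> W = {0}) * f X)"
    by (rule sum.swap)
  also have "\<dots> = (\<Sum>X\<in>grassmannian m. of_nat (card {W \<in> grassmannian k. U \<subseteq> W \<and> X \<inter> W = {0}}) * f X)"
  proof (rule sum.cong[OF refl])
    fix X :: "('a^'n) set"
    have "(\<Sum>W | W \<in> grassmannian k \<and> U \<subseteq> W. of_bool (X \<inter> W = {0}) * f X) =
      (\<Sum>W\<in>{W \<in> grassmannian k. U \<subseteq> W \<and> X \<inter> W = {0}}. f X)"
      by (rule sum.mono_neutral_cong_right) auto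
    then show "(\<Sum>W | W \<in> grassmannian k \<and> U \<subseteq> W. of_bool (X \<inter> W = {0}) * f X) =
      of_nat (card {W \<in> grassmannian k. U \<subseteq> W \<and> X \<inter> W = {0}}) * f X" by simp
  qed
  also have "\<dots> = (\<Sum>X\<in>grassmannian m. of_nat CARD('a) ^ (m * (k - vec.dim U)) * (of_bool (X \<inter> U = {0}) * f X))"
    by (rule sum.cong[OF refl]) (simp add: count)
  also have "\<dots> = of_nat CARD('a) ^ (m * (k - vec.dim U)) * disjoint_sum m f U"
    unfolding disjoint_sum_def sum_distrib_left[symmetric]
    by (intro arg_cong2[where f = "(*)"] refl sum.mono_neutral_cong_right) auto
  finally show ?thesis .
qed

text \<open>Take \<open>j\<close> minimal such that the superspace sums of the eigenvector on \<open>j\<close>-dimensional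
  subspaces do not all vanish. Then all but the top term of the Moebius inversion vanish, and these
  superspace sums are themselves an eigenvector with an explicit eigenvalue.\<close>

lemma disjoint_sum_eigenvalue:
  fixes f :: "('a::{field,finite}^'n) set \<Rightarrow> 'c::idom"
  assumes n: "k + m = CARD('n)" and km: "k \<le> m"
    and eig: "\<And>W. W \<in> grassmannian k \<Longrightarrow> disjoint_sum m (disjoint_sum k f) W = c * f W"
    and nz: "W0 \<in> grassmannian k" "f W0 \<noteq> 0"
  shows "\<exists>s. c = of_nat CARD('a) ^ s"
proof -
  let ?q = "of_nat CARD('a) :: 'c" and ?\<mu> = "\<lambda>T. mobius_coeff CARD('a) (vec.dim T) :: 'c"
  let ?P = "\<lambda>j. \<exists>U. vec.subspace U \<and> vec.dim U = j \<and> superspace_sum k f U \<noteq> 0"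
  have W0: "vec.subspace W0" "vec.dim W0 = k" using nz by (simp_all add: grassmannian_def)
  \<comment> \<open>Hence the superspace sum at \<open>W0\<close> is \<open>f W0\<close> itself, so
    the minimum \<open>j\<close> exists and is at most \<open>k\<close>.\<close>
  have "{W \<in> grassmannian k. W0 \<subseteq> W} = {W0}"
  proof (intro equalityI subsetI)
    fix W assume "W \<in> {W \<in> grassmannian k. W0 \<subseteq> W}"
    then have "vec.subspace W" "vec.dim W = k" "W0 \<subseteq> W" by (simp_all add: grassmannian_def)
    then show "W \<in> {W0}" using W0 vec.subspace_dim_equal[of W0 W] by simp
  qed (use nz in auto)
  then have "superspace_sum k f W0 = f W0" by (simp add: superspace_sum_def)
  then have Pk: "?P k" using W0 nz(2) by (intro exI[of _ W0]) simp
  define j where "j = (LEAST j. ?P j)"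
  have "?P j" unfolding j_def by (rule LeastI[of ?P, OF Pk])
  then obtain U where U: "vec.subspace U" "vec.dim U = j" "superspace_sum k f U \<noteq> 0" by blast
  have jk: "j \<le> k" unfolding j_def by (rule Least_le[of ?P, OF Pk])
  have low: "superspace_sum k f T = 0" if "vec.subspace T" "vec.dim T < j" for T
    using not_less_Least[of "vec.dim T" ?P] that unfolding j_def by blast
  have top: "(\<Sum>T | vec.subspace T \<and> T \<subseteq> U. g T) = g U"
    if U: "vec.subspace U" and g: "\<And>T. vec.subspace T \<Longrightarrow> vec.dim T < vec.dim U \<Longrightarrow> g T = 0"
    for U :: "('a^'n) set" and g :: "('a^'n) set \<Rightarrow> 'c"
  proof -
    have "g T = 0" if "vec.subspace T" "T \<subseteq> U" "T \<noteq> U" for T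
    proof -
      have "vec.dim T < vec.dim U"
        using vec.subspace_dim_equal[of T U] vec.dim_subset[of T U] that U by force
      then show ?thesis using g that by simp
    qed
    then have "(\<Sum>T | vec.subspace T \<and> T \<subseteq> U. g T) = (\<Sum>T\<in>{U}. g T)"
      using U by (intro sum.mono_neutral_right) auto
    then show ?thesis by simp
  qed
  \<comment> \<open>All proper subspaces of such a \<open>T\<close> have dimension below
    \<open>j\<close>, where the superspace sums vanish.\<close>
  have D: "disjoint_sum k f T = ?\<mu> T * superspace_sum k f T" if T: "vec.subspace T" "vec.dim T \<le> j" for T
    unfolding disjoint_sum_mobius[OF T(1)] by (rule top) (use T low in auto)
  have DD: "disjoint_sum m (disjoint_sum k f) U = ?\<mu> U * superspace_sum m (disjoint_sum k f) U"
    unfolding disjoint_sum_mobius[OF U(1)]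
  proof (rule top[OF U(1)])
    fix T :: "('a^'n) set" assume T: "vec.subspace T" "vec.dim T < vec.dim U"
    \<comment> \<open>Exchanging the sums gives a multiple of \<open>disjoint_sum k f T\<close>,
      which vanishes by \<open>D\<close> and \<open>low\<close>. The bound
      \<open>vec.dim T \<le> m\<close> comes from \<open>j \<le> k \<le> m\<close>.\<close>
    then have "superspace_sum m (disjoint_sum k f) T = 0"
      using superspace_sum_disjoint_sum[of T m k f] D[of T] low[of T] U jk km n by simp
    then show "?\<mu> T * superspace_sum m (disjoint_sum k f) T = 0" by simp
  qed
  \<comment> \<open>The exchange of sums is used twice, with the roles of \<open>k\<close> and
    \<open>m\<close> swapped, and each use gives a power of \<open>?q\<close>. The two Moebius
    inversions give one factor \<open>?\<mu> U\<close> each.\<close>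
  have "superspace_sum k (disjoint_sum m (disjoint_sum k f)) U
      = ?q ^ (m * (k - j)) * (?\<mu> U * (?q ^ (k * (m - j)) * (?\<mu> U * superspace_sum k f U)))"
    using superspace_sum_disjoint_sum[of U k m "disjoint_sum k f"] superspace_sum_disjoint_sum[of U m k f] DD D[of U] U jk km n
    by simp
  also have "\<dots> = ?q ^ (m * (k - j) + k * (m - j) + 2 * (j choose 2)) * superspace_sum k f U"
    using U(2) by (simp add: power_add flip: mobius_coeff_square)
  \<comment> \<open>The same quantity computed from the eigenvector equation; the nonzero factor
    \<open>superspace_sum k f U\<close> can then be cancelled.\<close>
  also have "superspace_sum k (disjoint_sum m (disjoint_sum k f)) U = c * superspace_sum k f U"
    unfolding superspace_sum_def sum_distrib_left by (rule sum.cong) (auto simp: eig)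
  finally show ?thesis using U(3) by auto
qed

section \<open>Kernels and their traces\<close>

text \<open>Matrix powers indexed by the vertices themselves. The semiring is left open: walks are
  counted in the natural numbers, eigenvalues are taken in the complex numbers.\<close>

primrec kernel_power :: "'v set \<Rightarrow> ('v \<Rightarrow> 'v \<Rightarrow> 'c::comm_semiring_1) \<Rightarrow> nat \<Rightarrow> 'v \<Rightarrow> 'v \<Rightarrow> 'c" where
  "kernel_power V A 0 x y = of_bool (x = y)"
| "kernel_power V A (Suc l) x y = (\<Sum>z\<in>V. A x z * kernel_power V A l z y)"

text \<open>The definition splits off a factor on the left; the cyclic shift of closed walks and the
  comparison with \<open>pow_mat\<close> need it on the right.\<close>

lemma kernel_power_Suc_right:
  assumes "finite V" "x \<in> V" "y \<in> V"
  shows "kernel_power V A (Suc l) x y = (\<Sum>z\<in>V. kernel_power V A l x z * A z y)"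
  using assms(2)
proof (induction l arbitrary: x)
  case 0
  have "(\<Sum>z\<in>V. A x z * of_bool (z = y)) = A x y" "(\<Sum>z\<in>V. of_bool (x = z) * A z y) = A x y"
    using assms 0 by (simp_all add: sum.remove[of V y] sum.remove[of V x])
  then show ?case by simp
next
  case (Suc l)
  have "kernel_power V A (Suc (Suc l)) x y = (\<Sum>z\<in>V. \<Sum>w\<in>V. A x z * (kernel_power V A l z w * A w y))"
    by (simp add: Suc.IH sum_distrib_left del: kernel_power.simps(2) add: kernel_power.simps(2)[of V A "Suc l"])
  also have "\<dots> = (\<Sum>w\<in>V. \<Sum>z\<in>V. A x z * (kernel_power V A l z w * A w y))" by (rule sum.swap)
  also have "\<dots> = (\<Sum>w\<in>V. kernel_power V A (Suc l) x w * A w y)"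
    by (simp add: sum_distrib_right mult.assoc)
  finally show ?case .
qed

lemma kernel_power_cong:
  assumes "\<And>x y. x \<in> V \<Longrightarrow> y \<in> V \<Longrightarrow> A x y = B x y" "x \<in> V"
  shows "kernel_power V A l x y = kernel_power V B l x y"
  using assms(2) by (induction l arbitrary: x) (simp_all add: assms(1) cong: sum.cong)

lemma of_nat_kernel_power:
  "of_nat (kernel_power V A l x y) = kernel_power V (\<lambda>x y. of_nat (A x y)) l x y"
  by (induction l arbitrary: x) simp_all

section \<open>Kernels with bipartite support\<close>

locale bipartite_kernel =
  fixes K L :: "'v set" and A :: "'v \<Rightarrow> 'v \<Rightarrow> 'c::comm_semiring_1"
  assumes finite_K: "finite K" and finite_L: "finite L" and disjoint: "K \<inter> L = {}"
    and zero_K: "x \<in> K \<Longrightarrow> y \<in> K \<Longrightarrow> A x y = 0" and zero_L: "x \<in> L \<Longrightarrow> y \<in> L \<Longrightarrow> A x y = 0"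
begin

lemma sum_step:
  "x \<in> K \<Longrightarrow> (\<Sum>z\<in>K \<union> L. A x z * g z) = (\<Sum>z\<in>L. A x z * g z)"
  "x \<in> L \<Longrightarrow> (\<Sum>z\<in>K \<union> L. A x z * g z) = (\<Sum>z\<in>K. A x z * g z)"
  "x \<in> L \<Longrightarrow> (\<Sum>z\<in>K \<union> L. g z * A z x) = (\<Sum>z\<in>K. g z * A z x)"
  by (simp_all add: sum.union_disjoint finite_K finite_L disjoint zero_K zero_L)

text \<open>Every nonzero step changes sides, so the parity of the length determines on which side a
  walk ends.\<close>

lemma kernel_power_parity:
  assumes "x \<in> K \<union> L" "y \<in> K \<union> L" "(x \<in> K \<longleftrightarrow> y \<in> K) \<longleftrightarrow> odd l"
  shows "kernel_power (K \<union> L) A l x y = 0"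
  using assms
proof (induction l arbitrary: x)
  case (Suc l)
  have "A x z * kernel_power (K \<union> L) A l z y = 0" if "z \<in> K \<union> L" for z
  proof (cases "x \<in> K \<longleftrightarrow> z \<in> K")
    case True
    then have "A x z = 0" using zero_K zero_L disjoint that Suc.prems by auto
    then show ?thesis by simp
  next
    case False
    then have "kernel_power (K \<union> L) A l z y = 0" using Suc.prems by (intro Suc.IH[OF that]) auto
    then show ?thesis by simp
  qed
  then show ?case by (simp add: sum.neutral)
qed auto

text \<open>Two steps from \<open>K\<close> lead through \<open>L\<close> back to \<open>K\<close>,
  so they act as one step of the product of the off-diagonal blocks.\<close>

lemma kernel_power_double:
  assumes "x \<in> K"
  shows "kernel_power (K \<union> L) A (2 * m) x y = kernel_power K (\<lambda>x y. \<Sum>z\<in>L. A x z * A z y) m x y"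
  using assms
proof (induction m arbitrary: x)
  case (Suc m)
  have "kernel_power (K \<union> L) A (2 * Suc m) x y
      = (\<Sum>z\<in>K \<union> L. A x z * (\<Sum>w\<in>K \<union> L. A z w * kernel_power (K \<union> L) A (2 * m) w y))"
    by simp
  also have "\<dots> = (\<Sum>z\<in>L. A x z * (\<Sum>w\<in>K. A z w * kernel_power (K \<union> L) A (2 * m) w y))"
    using Suc.prems by (simp add: sum_step cong: sum.cong)
  also have "\<dots> = (\<Sum>z\<in>L. \<Sum>w\<in>K. A x z * A z w * kernel_power K (\<lambda>x y. \<Sum>z\<in>L. A x z * A z y) m w y)"
    by (simp add: Suc.IH sum_distrib_left mult.assoc)
  also have "\<dots> = (\<Sum>w\<in>K. \<Sum>z\<in>L. A x z * A z w * kernel_power K (\<lambda>x y. \<Sum>z\<in>L. A x z * A z y) m w y)"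
    by (rule sum.swap)
  finally show ?case by (simp add: sum_distrib_right)
qed simp

text \<open>Moving the first step of a closed walk to its end shifts the base point from
  \<open>K\<close> to \<open>L\<close>. This needs positive length: for length 0 the sums are the
  sizes of \<open>L\<close> and \<open>K\<close>.\<close>

lemma trace_parts_eq:
  "(\<Sum>x\<in>L. kernel_power (K \<union> L) A (Suc l) x x) = (\<Sum>x\<in>K. kernel_power (K \<union> L) A (Suc l) x x)"
proof -
  have "(\<Sum>x\<in>K. kernel_power (K \<union> L) A (Suc l) x x) = (\<Sum>x\<in>K. \<Sum>z\<in>L. A x z * kernel_power (K \<union> L) A l z x)"
    by (simp add: sum_step)
  also have "\<dots> = (\<Sum>z\<in>L. \<Sum>x\<in>K. A x z * kernel_power (K \<union> L) A l z x)" by (rule sum.swap)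
  also have "\<dots> = (\<Sum>z\<in>L. \<Sum>x\<in>K. kernel_power (K \<union> L) A l z x * A x z)" by (simp only: mult.commute)
  also have "\<dots> = (\<Sum>z\<in>L. kernel_power (K \<union> L) A (Suc l) z z)"
    using finite_K finite_L by (simp add: kernel_power_Suc_right sum_step del: kernel_power.simps)
  finally show ?thesis by simp
qed

lemma trace_kernel_power:
  assumes "l > 0"
  shows "(\<Sum>x\<in>K \<union> L. kernel_power (K \<union> L) A l x x) =
    (if odd l then 0 else 2 * (\<Sum>x\<in>K. kernel_power K (\<lambda>x y. \<Sum>z\<in>L. A x z * A z y) (l div 2) x x))"
proof (cases "odd l")
  case True
  then show ?thesis by (simp add: kernel_power_parity sum.neutral)
next
  case False
  have "(\<Sum>x\<in>K \<union> L. kernel_power (K \<union> L) A l x x) = 2 * (\<Sum>x\<in>K. kernel_power (K \<union> L) A l x x)"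
    using trace_parts_eq[of "l - 1"] assms
    by (simp add: sum.union_disjoint finite_K finite_L disjoint mult_2)
  also have "(\<Sum>x\<in>K. kernel_power (K \<union> L) A l x x) =
      (\<Sum>x\<in>K. kernel_power K (\<lambda>x y. \<Sum>z\<in>L. A x z * A z y) (l div 2) x x)"
    using False by (intro sum.cong refl) (simp flip: kernel_power_double del: kernel_power.simps)
  finally show ?thesis unfolding if_not_P[OF False] .
qed

end

section \<open>Traces of matrix powers as power sums of eigenvalues\<close>

definition mat_trace :: "'c::comm_ring_1 mat \<Rightarrow> 'c" where
  "mat_trace M = (\<Sum>i<dim_row M. M $$ (i, i))"

lemma mat_trace_comm:
  assumes "M \<in> carrier_mat n n" "N \<in> carrier_mat n n"
  shows "mat_trace (M * N) = mat_trace (N * M)"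
proof -
  have *: "mat_trace (M * N) = (\<Sum>i<n. \<Sum>j<n. M $$ (i, j) * N $$ (j, i))"
    "mat_trace (N * M) = (\<Sum>j<n. \<Sum>i<n. M $$ (i, j) * N $$ (j, i))"
    using assms by (auto simp: mat_trace_def scalar_prod_def atLeast0LessThan mult.commute intro!: sum.cong)
  show ?thesis unfolding * by (rule sum.swap)
qed

lemma mat_trace_similar:
  assumes "similar_mat_wit M N P Q"
  shows "mat_trace M = mat_trace N"
proof -
  note D = similar_mat_witD[OF refl assms]
  have "mat_trace (P * N * Q) = mat_trace (Q * (P * N))"
    by (rule mat_trace_comm[OF mult_carrier_mat[OF D(6,5)] D(7)])
  also have "Q * (P * N) = N"
    unfolding assoc_mult_mat[OF D(7,6,5), symmetric] D(2) by (rule left_mult_one_mat[OF D(5)])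
  finally show ?thesis unfolding D(3)[symmetric] .
qed

text \<open>A term \<open>M $$ (i, k) * N $$ (k, j)\<close> can be nonzero only for
  \<open>i \<le> k \<le> j\<close>.\<close>

lemma upper_triangular_mult:
  fixes M N :: "'c::comm_ring_1 mat"
  assumes "M \<in> carrier_mat n n" "N \<in> carrier_mat n n" "upper_triangular M" "upper_triangular N"
  shows "upper_triangular (M * N)" and "i < n \<Longrightarrow> (M * N) $$ (i, i) = M $$ (i, i) * N $$ (i, i)"
proof -
  have entry: "(M * N) $$ (i, j) = (\<Sum>k<n. M $$ (i, k) * N $$ (k, j))" if "i < n" "j < n" for i j
    using assms that by (auto simp: scalar_prod_def atLeast0LessThan intro!: sum.cong)
  have zero: "M $$ (i, k) * N $$ (k, j) = 0" if "i < n" "k < n" "k < i \<or> j < k" for i j k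
    using that(3)
  proof
    assume "k < i"
    then have "M $$ (i, k) = 0" using assms(1) that(1) by (intro upper_triangularD[OF assms(3)]) auto
    then show ?thesis by simp
  next
    assume "j < k"
    then have "N $$ (k, j) = 0" using assms(2) that(2) by (intro upper_triangularD[OF assms(4)]) auto
    then show ?thesis by simp
  qed
  show "upper_triangular (M * N)"
  proof (rule upper_triangularI)
    fix i j assume "j < i" "i < dim_row (M * N)"
    then have "i < n" "j < n" using assms by auto
    then show "(M * N) $$ (i, j) = 0"
      unfolding entry[OF \<open>i < n\<close> \<open>j < n\<close>] using \<open>j < i\<close> by (intro sum.neutral ballI zero) auto
  qed
  assume i: "i < n"
  have "(M * N) $$ (i, i) = (\<Sum>k\<in>{i}. M $$ (i, k) * N $$ (k, i))"
    unfolding entry[OF i i] by (rule sum.mono_neutral_right) (use i in \<open>auto intro!: zero\<close>)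
  then show "(M * N) $$ (i, i) = M $$ (i, i) * N $$ (i, i)" by simp
qed

lemma upper_triangular_pow:
  fixes M :: "'c::comm_ring_1 mat"
  assumes M: "M \<in> carrier_mat n n" "upper_triangular M"
  shows "upper_triangular (M ^\<^sub>m m) \<and> (\<forall>i<n. (M ^\<^sub>m m) $$ (i, i) = M $$ (i, i) ^ m)"
proof (induction m)
  case (Suc m)
  note mult = upper_triangular_mult[OF pow_carrier_mat[OF M(1), of m] M(1) conjunct1[OF Suc] M(2)]
  show ?case
    unfolding pow_mat.simps power_Suc2 using Suc by (simp add: mult del: index_mult_mat)
qed (use M in auto)

text \<open>The characteristic polynomial splits over the complex numbers, so Schur decomposition
  gives a similar triangular matrix with its roots on the diagonal. Powers of that matrix have the
  powers of the roots there, and similarity preserves the trace.\<close>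

lemma mat_trace_pow:
  fixes M :: "complex mat"
  assumes M: "M \<in> carrier_mat n n"
  obtains es where "\<forall>c\<in>set es. eigenvalue M c" "\<And>m. mat_trace (M ^\<^sub>m m) = (\<Sum>c\<leftarrow>es. c ^ m)"
proof -
  obtain es where es: "char_poly M = (\<Prod>a\<leftarrow>es. [:- a, 1:])" using char_poly_factorized[OF M] by blast
  obtain N P Q where N: "schur_decomposition M es = (N, P, Q)" by (cases "schur_decomposition M es") auto
  have sim: "similar_mat_wit M N P Q" and ut: "upper_triangular N" and diag: "diag_mat N = es"
    using schur_decomposition[OF M es N] by auto
  have carrier: "N \<in> carrier_mat n n" using similar_mat_witD2[OF M sim] by simp
  have "mat_trace (M ^\<^sub>m m) = (\<Sum>c\<leftarrow>es. c ^ m)" for m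
  proof -
    have "mat_trace (M ^\<^sub>m m) = mat_trace (N ^\<^sub>m m)"
      by (rule mat_trace_similar[OF similar_mat_wit_pow[OF sim]])
    also have "\<dots> = (\<Sum>i<n. N $$ (i, i) ^ m)"
      using upper_triangular_pow[OF carrier ut, of m] carrier by (simp add: mat_trace_def)
    also have "\<dots> = (\<Sum>c\<leftarrow>diag_mat N. c ^ m)"
      using carrier by (simp add: diag_mat_def interv_sum_list_conv_sum_set_nat atLeast0LessThan o_def)
    finally show ?thesis by (simp add: diag)
  qed
  moreover have "\<forall>c\<in>set es. eigenvalue M c"
    using es by (auto simp: eigenvalue_root_char_poly[OF M] poly_prod_list prod_list_zero_iff)
  ultimately show thesis using that by blast
qed

text \<open>An enumeration of \<open>V\<close> turns the kernel into a matrix, to which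
  \<open>mat_trace_pow\<close> applies. The predicate \<open>P\<close> allows the eigenvalues to be
  restricted by an argument about eigenfunctions on \<open>V\<close>.\<close>

lemma trace_kernel_power_eigenvalues:
  fixes A :: "'v \<Rightarrow> 'v \<Rightarrow> complex"
  assumes "finite V"
    and eig: "\<And>c f x. (\<And>y. y \<in> V \<Longrightarrow> (\<Sum>z\<in>V. A y z * f z) = c * f y) \<Longrightarrow> x \<in> V \<Longrightarrow> f x \<noteq> 0 \<Longrightarrow> P c"
  obtains es where "\<forall>c\<in>set es. P c" "\<And>m. (\<Sum>x\<in>V. kernel_power V A m x x) = (\<Sum>c\<leftarrow>es. c ^ m)"
proof -
  define n where "n = card V"
  obtain h where h: "bij_betw h {..<n} V"
    using ex_bij_betw_nat_finite[OF assms(1)] by (auto simp: n_def atLeast0LessThan)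
  have hV: "h i \<in> V" if "i < n" for i using h that by (auto dest: bij_betwE)
  have sum_V: "(\<Sum>x\<in>V. g x) = (\<Sum>i<n. g (h i))" for g :: "'v \<Rightarrow> complex"
    by (rule sum.reindex_bij_betw[OF h, symmetric])
  define M where "M = mat n n (\<lambda>(i, j). A (h i) (h j))"
  have M: "M \<in> carrier_mat n n" by (simp add: M_def)
  have pow: "(M ^\<^sub>m m) $$ (i, j) = kernel_power V A m (h i) (h j)" if "i < n" "j < n" for m i j
    using that
  proof (induction m arbitrary: i j)
    case 0
    then show ?case using h M by (auto simp: bij_betw_def inj_on_def)
  next
    case (Suc m)
    have "(M ^\<^sub>m Suc m) $$ (i, j) = (\<Sum>k<n. (M ^\<^sub>m m) $$ (i, k) * A (h k) (h j))"
      using M Suc.prems by (auto simp: scalar_prod_def atLeast0LessThan M_def intro!: sum.cong)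
    also have "\<dots> = kernel_power V A (Suc m) (h i) (h j)"
      using Suc hV assms(1) by (simp add: kernel_power_Suc_right sum_V del: kernel_power.simps)
    finally show ?case .
  qed
  obtain es where es: "\<forall>c\<in>set es. eigenvalue M c" "\<And>m. mat_trace (M ^\<^sub>m m) = (\<Sum>c\<leftarrow>es. c ^ m)"
    using mat_trace_pow[OF M] by blast
  have "(\<Sum>x\<in>V. kernel_power V A m x x) = (\<Sum>c\<leftarrow>es. c ^ m)" for m
    using M by (simp add: es(2)[symmetric] mat_trace_def sum_V pow)
  moreover have "P c" if c: "c \<in> set es" for c
  proof -
    obtain v where v: "v \<in> carrier_vec n" "v \<noteq> 0\<^sub>v n" "M *\<^sub>v v = c \<cdot>\<^sub>v v"
      using bspec[OF es(1) c] M by (auto simp: eigenvalue_def eigenvector_def)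
    then obtain i where i: "i < n" "vec_index v i \<noteq> 0" by (metis carrier_vecD eq_vecI index_zero_vec)
    define f where "f x = vec_index v (inv_into {..<n} h x)" for x
    have fh: "f (h j) = vec_index v j" if "j < n" for j
      using that h by (simp add: f_def bij_betw_def)
    show "P c"
    proof (rule eig)
      show "h i \<in> V" "f (h i) \<noteq> 0" using i hV fh by auto
      fix y assume "y \<in> V"
      then obtain j where j: "j < n" "y = h j" using h by (auto simp: bij_betw_def)
      have "vec_index (M *\<^sub>v v) j = (\<Sum>k<n. A (h j) (h k) * f (h k))"
        using j(1) v(1) fh by (auto simp: M_def scalar_prod_def atLeast0LessThan intro!: sum.cong)
      then show "(\<Sum>z\<in>V. A y z * f z) = c * f y"
        using j v fh by (simp add: sum_V)
    qed
  qed
  ultimately show thesis using that by blast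
qed

section \<open>Closed walks and the zeta function\<close>

text \<open>Splits off the first step of a walk. The sets in the union differ in the first vertex of
  their walks, so their sizes add up.\<close>

lemma bij_betw_walks_Suc:
  assumes "x \<in> verts G"
  shows "bij_betw ((#) x) (\<Union>z\<in>{z \<in> verts G. (x, z) \<in> arcs_ends G}.
      {p. vwalk p G \<and> vwalk_length p = l \<and> hd p = z \<and> last p = y})
    {p. vwalk p G \<and> vwalk_length p = Suc l \<and> hd p = x \<and> last p = y}" (is "bij_betw _ ?S ?T")
proof (rule bij_betwI')
  fix p assume p: "p \<in> ?S"
  then have "p \<noteq> []" "(x, hd p) \<in> arcs_ends G" "vwalk p G" by (auto simp: vwalk_def)
  then show "x # p \<in> ?T" using p assms by (cases p) (auto intro: vwalk_consI)
next
  fix p assume p: "p \<in> ?T"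
  then obtain z r where "p = x # z # r" by (cases p; cases "tl p") auto
  with p show "\<exists>r\<in>?S. p = x # r" by (auto simp: vwalk_def)
qed auto

text \<open>Finiteness is carried through the induction because the cardinality of the disjoint
  union requires finite pieces.\<close>

lemma card_walks:
  assumes "finite (verts G)" "x \<in> verts G"
  shows "finite {p. vwalk p G \<and> vwalk_length p = l \<and> hd p = x \<and> last p = y} \<and>
    card {p. vwalk p G \<and> vwalk_length p = l \<and> hd p = x \<and> last p = y}
      = kernel_power (verts G) (\<lambda>x y. of_bool ((x, y) \<in> arcs_ends G)) l x y"
  using assms(2)
proof (induction l arbitrary: x)
  case (0 x)
  have len: "vwalk p G \<and> vwalk_length p = 0 \<Longrightarrow> \<exists>z. p = [z]" for p by (cases p) (auto simp: vwalk_def)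
  have "{p. vwalk p G \<and> vwalk_length p = 0 \<and> hd p = x \<and> last p = y} = (if x = y then {[x]} else {})"
    using 0 by (auto dest!: len[OF conjI] simp del: vwalk_length_simp) (auto simp: vwalk_def)
  then show ?case by (simp only:) auto
next
  case (Suc l x)
  let ?W = "\<lambda>l z. {p. vwalk p G \<and> vwalk_length p = l \<and> hd p = z \<and> last p = y}"
  let ?Z = "{z \<in> verts G. (x, z) \<in> arcs_ends G}"
  note bij = bij_betw_walks_Suc[OF Suc.prems, of l y]
  have "card (?W (Suc l) x) = card (\<Union>z\<in>?Z. ?W l z)"
    using bij_betw_same_card[OF bij] by simp
  also have "\<dots> = (\<Sum>z\<in>?Z. card (?W l z))"
    by (rule card_UN_disjoint) (use assms(1) Suc.IH in auto)
  also have "\<dots> = (\<Sum>z\<in>?Z. kernel_power (verts G) (\<lambda>x y. of_bool ((x, y) \<in> arcs_ends G)) l z y)"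
    by (rule sum.cong[OF refl]) (use Suc.IH in blast)
  also have "\<dots> = kernel_power (verts G) (\<lambda>x y. of_bool ((x, y) \<in> arcs_ends G)) (Suc l) x y"
    unfolding kernel_power.simps by (rule sum.mono_neutral_cong_left) (use assms(1) in auto)
  finally have "card (?W (Suc l) x) = \<dots>" .
  moreover have "finite (\<Union>z\<in>?Z. ?W l z)"
    using assms(1) Suc.IH by (intro finite_UN_I) auto
  then have "finite (?W (Suc l) x)" using bij_betw_finite[OF bij] by blast
  ultimately show ?case by blast
qed

lemma closed_walk_count_eq_trace:
  assumes "finite (verts G)"
  shows "closed_walk_count G l =
    (\<Sum>x\<in>verts G. kernel_power (verts G) (\<lambda>x y. of_bool ((x, y) \<in> arcs_ends G)) l x x)"
proof -
  have "{p. vwalk p G \<and> vwalk_length p = l \<and> hd p = last p} =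
      (\<Union>x\<in>verts G. {p. vwalk p G \<and> vwalk_length p = l \<and> hd p = x \<and> last p = x})"
    by (auto simp: vwalk_def subset_iff)
  then have "closed_walk_count G l =
      card (\<Union>x\<in>verts G. {p. vwalk p G \<and> vwalk_length p = l \<and> hd p = x \<and> last p = x})"
    by (simp only: closed_walk_count_def)
  also have "\<dots> = (\<Sum>x\<in>verts G. card {p. vwalk p G \<and> vwalk_length p = l \<and> hd p = x \<and> last p = x})"
    by (rule card_UN_disjoint) (use assms card_walks[OF assms] in \<open>auto simp del: vwalk_length_simp\<close>)
  also have "\<dots> = (\<Sum>x\<in>verts G. kernel_power (verts G) (\<lambda>x y. of_bool ((x, y) \<in> arcs_ends G)) l x x)"
    by (rule sum.cong[OF refl]) (rule conjunct2[OF card_walks[OF assms]])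
  finally show ?thesis .
qed

text \<open>The product has derivative zero, hence equals its constant coefficient, which is
  1.\<close>

lemma fps_exp_compose_mult_eq_1:
  fixes F P :: "'c::field_char_0 fps"
  assumes F0: "fps_nth F 0 = 0" and P0: "fps_nth P 0 = 1" and deriv: "fps_deriv P = - (fps_deriv F * P)"
  shows "(fps_exp 1 oo F) * P = 1"
proof -
  have "fps_deriv (fps_exp 1 oo F) = (fps_exp 1 oo F) * fps_deriv F"
    using fps_compose_deriv[OF F0, of "fps_exp 1"] by simp
  then have "fps_deriv ((fps_exp 1 oo F) * P) = 0"
    by (simp add: deriv algebra_simps)
  then have "(fps_exp 1 oo F) * P = fps_const (fps_nth ((fps_exp 1 oo F) * P) 0)"
    by (rule iffD1[OF fps_deriv_eq_0_iff])
  then show ?thesis by (simp add: P0)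
qed

text \<open>The derivative of the exponent is minus the logarithmic derivative of the claimed
  product, and the constant coefficients fit.\<close>

lemma inverse_cycle_zeta:
  fixes S :: "nat multiset"
  assumes count: "\<And>l. l > 0 \<Longrightarrow>
    closed_walk_count G l = (if odd l then 0 else 2 * (\<Sum>s\<in>#S. (q ^ s) ^ (l div 2)))"
  shows "1 / cycle_zeta G = (\<Prod>s\<in>#S. 1 - fps_const (of_nat q ^ s) * fps_X ^ 2)"
proof -
  define F :: "rat fps" where "F = Abs_fps (\<lambda>l. of_nat (closed_walk_count G l) / of_nat l)"
  define P :: "nat multiset \<Rightarrow> rat fps" where "P S = (\<Prod>s\<in>#S. 1 - fps_const (of_nat q ^ s) * fps_X ^ 2)" for S
  \<comment> \<open>The expansion of 2 q^s u / (1 - q^s u^2). Differentiation cancels the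
    denominator \<open>l\<close> and lowers the index by one, so even indices belong to odd walk
    lengths.\<close>
  define D :: "nat \<Rightarrow> rat fps" where
    "D s = Abs_fps (\<lambda>l. if even l then 0 else 2 * (of_nat q ^ s) ^ (Suc l div 2))" for s
  have "fps_nth (fps_deriv F) l = (\<Sum>s\<in>#S. fps_nth (D s) l)" for l
    using count[of "Suc l"] by (simp add: F_def D_def sum_mset_distrib_left multiset.map_comp o_def del: power_Suc)
  moreover have "(\<Sum>s\<in>#S. fps_nth (D s) l) = fps_nth (\<Sum>s\<in>#S. D s) l" for l
    by (induction S) simp_all
  ultimately have F': "fps_deriv F = (\<Sum>s\<in>#S. D s)" by (intro fps_ext) (rule trans)
  have D: "D s * (1 - fps_const (of_nat q ^ s) * fps_X ^ 2) = fps_const (2 * of_nat q ^ s) * fps_X" for s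
  proof (rule fps_ext)
    fix l
    have "D s * (1 - fps_const (of_nat q ^ s) * fps_X ^ 2) = D s - fps_const (of_nat q ^ s) * (fps_X ^ 2 * D s)"
      by (simp only: right_diff_distrib mult_1_right mult_1_left mult.commute mult.left_commute)
    then have "fps_nth (D s * (1 - fps_const (of_nat q ^ s) * fps_X ^ 2)) l =
        fps_nth (D s) l - of_nat q ^ s * (if l < 2 then 0 else fps_nth (D s) (l - 2))"
      by (simp only: fps_sub_nth fps_mult_left_const_nth fps_X_power_mult_nth)
    also have "\<dots> = (if l = 1 then 2 * of_nat q ^ s else 0)"
    proof (cases "l < 2")
      case True
      then have "l = 0 \<or> l = 1" by auto
      then show ?thesis by (auto simp: D_def)
    next
      case False
      then obtain k where "l = Suc (Suc k)" by (metis One_nat_def Suc_1 add_2_eq_Suc le_Suc_ex not_less)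
      then show ?thesis by (simp add: D_def)
    qed
    also have "\<dots> = fps_nth (fps_const (2 * of_nat q ^ s) * fps_X) l"
      by (simp only: fps_mult_left_const_nth fps_X_nth) simp
    finally show "fps_nth (D s * (1 - fps_const (of_nat q ^ s) * fps_X ^ 2)) l
      = fps_nth (fps_const (2 * of_nat q ^ s) * fps_X) l" .
  qed
  have "fps_deriv (P S) = - ((\<Sum>s\<in>#S. D s) * P S)" for S
  proof (induction S)
    case (add s S)
    let ?p = "1 - fps_const (of_nat q ^ s) * fps_X ^ 2 :: rat fps"
    have "fps_deriv (P (add_mset s S)) = fps_deriv ?p * P S + ?p * fps_deriv (P S)"
      by (simp add: P_def)
    also have "fps_deriv ?p = - (D s * ?p)"
      unfolding D by (simp add: fps_deriv_power numeral_fps_const mult.commute)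
    also have "fps_deriv (P S) = - ((\<Sum>s\<in>#S. D s) * P S)" by (rule add.IH)
    finally show ?case by (simp add: P_def algebra_simps)
  qed (simp add: P_def)
  moreover have "fps_nth (P S) 0 = 1" by (induction S) (simp_all add: P_def)
  moreover have "fps_nth F 0 = 0" by (simp add: F_def)
  ultimately have "(fps_exp 1 oo F) * P S = 1"
    by (intro fps_exp_compose_mult_eq_1) (simp_all only: F')
  then have "1 / cycle_zeta G = P S"
    unfolding cycle_zeta_def F_def[symmetric]
    by (metis mult_zero_left nonzero_mult_div_cancel_left zero_neq_one)
  then show ?thesis by (simp add: P_def)
qed

section \<open>The complement graph\<close>

text \<open>Reduces the case \<open>2 * k > n\<close> to \<open>2 * k < n\<close>.\<close>

lemma complement_graph_dim_diff:
  assumes "k \<le> CARD('n)"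
  shows "complement_graph_dim (CARD('n) - k) =
    (complement_graph_dim k :: (('a::field^'n) set, ('a^'n) set \<times> ('a^'n) set) pre_digraph)"
  using assms by (simp add: complement_graph_dim_def disj_commute)

lemma complement_graph_dim_verts:
  assumes "0 < k" "0 < m" "k + m = CARD('n)"
  shows "verts (complement_graph_dim k :: (('a::field^'n) set, ('a^'n) set \<times> ('a^'n) set) pre_digraph)
    = grassmannian k \<union> grassmannian m"
proof -
  have "W \<noteq> {0} \<and> W \<noteq> UNIV" if "vec.dim W = k \<or> vec.dim W = m" for W :: "('a^'n) set"
  proof -
    have "vec.dim {0 :: 'a^'n} = 0" by simp
    moreover have "vec.dim W \<noteq> 0" "vec.dim W \<noteq> CARD('n)" using that assms by linarith+
    ultimately show ?thesis using vec_dim_card[where 'a = 'a and 'n = 'n] by metis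
  qed
  moreover have "CARD('n) - k = m" using assms by simp
  ultimately show ?thesis
    by (auto simp: complement_graph_dim_def complement_graph_def Let_def grassmannian_def)
qed

text \<open>In this form it is visible that for \<open>k \<noteq> m\<close> no arc joins two
  subspaces of equal dimension, since neither \<open>2 * k\<close> nor \<open>2 * m\<close> is
  \<open>k + m\<close>.\<close>

lemma complement_graph_dim_arcs_ends:
  fixes x y :: "('a::field^'n) set"
  assumes km: "0 < k" "0 < m" "k + m = CARD('n)"
    and x: "x \<in> grassmannian k \<union> grassmannian m" and y: "y \<in> grassmannian k \<union> grassmannian m"
  shows "(x, y) \<in> arcs_ends (complement_graph_dim k :: (('a^'n) set, ('a^'n) set \<times> ('a^'n) set) pre_digraph)
    \<longleftrightarrow> x \<inter> y = {0} \<and> vec.dim x + vec.dim y = k + m"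
proof -
  let ?G = "complement_graph_dim k :: (('a^'n) set, ('a^'n) set \<times> ('a^'n) set) pre_digraph"
  have V: "x \<in> verts ?G" "y \<in> verts ?G" using complement_graph_dim_verts[OF km] x y by auto
  then have "(x, y) \<in> arcs_ends ?G \<longleftrightarrow> x \<inter> y = {0} \<and> {a + b | a b. a \<in> x \<and> b \<in> y} = UNIV"
    by (auto simp: complement_graph_dim_def complement_graph_def Let_def arcs_ends_def arc_to_ends_def image_iff)
  also have "\<dots> \<longleftrightarrow> x \<inter> y = {0} \<and> vec.dim x + vec.dim y = vec.dim (UNIV :: ('a^'n) set)"
  proof (rule conj_cong[OF refl])
    assume "x \<inter> y = {0}"
    then show "{a + b | a b. a \<in> x \<and> b \<in> y} = UNIV \<longleftrightarrow> vec.dim x + vec.dim y = vec.dim (UNIV :: ('a^'n) set)"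
      using x y by (intro complement_sums_iff) (auto simp: grassmannian_def)
  qed
  finally show ?thesis unfolding vec_dim_card km(3) .
qed

text \<open>The kernel on the right is the product of the two off-diagonal blocks: it counts the
  common complements of \<open>x\<close> and \<open>y\<close>.\<close>

lemma closed_walk_count_complement_graph_dim:
  assumes km: "0 < k" "k < m" "k + m = CARD('n)" and l: "l > 0"
  shows "closed_walk_count (complement_graph_dim k :: (('a::{field,finite}^'n) set, ('a^'n) set \<times> ('a^'n) set) pre_digraph) l =
    (if odd l then 0 else 2 * (\<Sum>x\<in>grassmannian k. kernel_power (grassmannian k)
      (\<lambda>x y. card {z \<in> grassmannian m :: ('a^'n) set set. x \<inter> z = {0} \<and> z \<inter> y = {0}}) (l div 2) x x))"
proof -
  let ?G = "complement_graph_dim k :: (('a^'n) set, ('a^'n) set \<times> ('a^'n) set) pre_digraph"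
  let ?K = "grassmannian k :: ('a^'n) set set" and ?L = "grassmannian m :: ('a^'n) set set"
  let ?A = "\<lambda>x y. of_bool ((x, y) \<in> arcs_ends ?G) :: nat"
  have m: "0 < m" using km by simp
  note arcs = complement_graph_dim_arcs_ends[OF km(1) m km(3)]
  interpret bipartite_kernel ?K ?L ?A
  proof
    show "?K \<inter> ?L = {}" using km(2) by (auto simp: grassmannian_def)
    show "?A x y = 0" if "x \<in> ?K" "y \<in> ?K" for x y
      using arcs[of x y] that km(2) by (simp add: grassmannian_def)
    show "?A x y = 0" if "x \<in> ?L" "y \<in> ?L" for x y
      using arcs[of x y] that km(2) by (simp add: grassmannian_def)
  qed auto
  have A: "?A x z = of_bool (x \<inter> z = {0})" "?A z x = of_bool (z \<inter> x = {0})"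
    if "x \<in> ?K" "z \<in> ?L" for x z
    using arcs[of x z] arcs[of z x] that by (simp_all add: grassmannian_def)
  have square: "(\<Sum>z\<in>?L. ?A x z * ?A z y) = card {z \<in> ?L. x \<inter> z = {0} \<and> z \<inter> y = {0}}"
    if "x \<in> ?K" "y \<in> ?K" for x y
  proof -
    have "(\<Sum>z\<in>?L. ?A x z * ?A z y) = (\<Sum>z\<in>{z \<in> ?L. x \<inter> z = {0} \<and> z \<inter> y = {0}}. 1)"
      using A that by (intro sum.mono_neutral_cong_right) auto
    then show ?thesis by simp
  qed
  have "kernel_power ?K (\<lambda>x y. \<Sum>z\<in>?L. ?A x z * ?A z y) j x y =
      kernel_power ?K (\<lambda>x y. card {z \<in> ?L. x \<inter> z = {0} \<and> z \<inter> y = {0}}) j x y"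
    if "x \<in> ?K" for j x y
    using square that by (rule kernel_power_cong)
  then have "(\<Sum>x\<in>?K. kernel_power ?K (\<lambda>x y. \<Sum>z\<in>?L. ?A x z * ?A z y) (l div 2) x x) =
      (\<Sum>x\<in>?K. kernel_power ?K (\<lambda>x y. card {z \<in> ?L. x \<inter> z = {0} \<and> z \<inter> y = {0}}) (l div 2) x x)"
    by (intro sum.cong refl)
  moreover have "verts ?G = ?K \<union> ?L" by (rule complement_graph_dim_verts[OF km(1) m km(3)])
  moreover have "closed_walk_count ?G l = (\<Sum>x\<in>verts ?G. kernel_power (verts ?G) ?A l x x)"
    by (rule closed_walk_count_eq_trace) simp
  ultimately show ?thesis using trace_kernel_power[OF l] by (simp only:)
qed

text \<open>Identifies the action of the common-complement kernel with the operator treated in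
  \<open>disjoint_sum_eigenvalue\<close>.\<close>

lemma sum_card_common_complements:
  fixes f :: "('a::{field,finite}^'n) set \<Rightarrow> 'c::comm_ring_1"
  shows "(\<Sum>x\<in>grassmannian k. of_nat (card {z \<in> grassmannian m. y \<inter> z = {0} \<and> z \<inter> x = {0}}) * f x)
    = disjoint_sum m (disjoint_sum k f) y"
proof -
  have "of_nat (card {z \<in> grassmannian m. y \<inter> z = {0} \<and> z \<inter> x = {0}}) * f x =
      (\<Sum>z | z \<in> grassmannian m \<and> z \<inter> y = {0}. of_bool (x \<inter> z = {0}) * f x)" for x :: "('a^'n) set"
  proof -
    have "(\<Sum>z | z \<in> grassmannian m \<and> z \<inter> y = {0}. of_bool (x \<inter> z = {0}) * f x) =
        (\<Sum>z\<in>{z \<in> grassmannian m. y \<inter> z = {0} \<and> z \<inter> x = {0}}. f x)"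
      by (intro sum.mono_neutral_cong_right) (auto simp: Int_commute)
    then show ?thesis by simp
  qed
  then have "(\<Sum>x\<in>grassmannian k. of_nat (card {z \<in> grassmannian m. y \<inter> z = {0} \<and> z \<inter> x = {0}}) * f x) =
      (\<Sum>x\<in>grassmannian k. \<Sum>z | z \<in> grassmannian m \<and> z \<inter> y = {0}. of_bool (x \<inter> z = {0}) * f x)"
    by (intro sum.cong refl)
  also have "\<dots> = (\<Sum>z | z \<in> grassmannian m \<and> z \<inter> y = {0}. \<Sum>x\<in>grassmannian k. of_bool (x \<inter> z = {0}) * f x)"
    by (rule sum.swap)
  also have "\<dots> = disjoint_sum m (disjoint_sum k f) y"
    unfolding disjoint_sum_def by (intro sum.cong[OF refl] sum.mono_neutral_cong_right) auto
  finally show ?thesis .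
qed

lemma inverse_cycle_zeta_complement_graph_dim:
  assumes km: "0 < k" "k < m" "k + m = CARD('n)"
  obtains S :: "nat multiset" where
    "1 / cycle_zeta (complement_graph_dim k :: (('a::{field,finite}^'n) set, ('a^'n) set \<times> ('a^'n) set) pre_digraph)
      = (\<Prod>s\<in>#S. 1 - fps_const (of_nat CARD('a) ^ s) * fps_X ^ 2)"
proof -
  let ?G = "complement_graph_dim k :: (('a^'n) set, ('a^'n) set \<times> ('a^'n) set) pre_digraph"
  let ?K = "grassmannian k :: ('a^'n) set set"
  let ?N = "\<lambda>x y. card {z \<in> grassmannian m :: ('a^'n) set set. x \<inter> z = {0} \<and> z \<inter> y = {0}}"
  let ?q = "CARD('a)"
  obtain es :: "complex list" where es: "\<forall>c\<in>set es. \<exists>s. c = of_nat ?q ^ s"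
    and trace: "\<And>j. (\<Sum>x\<in>?K. kernel_power ?K (\<lambda>x y. of_nat (?N x y)) j x x) = (\<Sum>c\<leftarrow>es. c ^ j)"
  proof (rule trace_kernel_power_eigenvalues[of ?K "\<lambda>x y. of_nat (?N x y)" "\<lambda>c. \<exists>s. c = of_nat ?q ^ s"])
    fix c :: complex and f and x :: "('a^'n) set"
    assume eig: "\<And>y. y \<in> ?K \<Longrightarrow> (\<Sum>z\<in>?K. of_nat (?N y z) * f z) = c * f y"
      and x: "x \<in> ?K" "f x \<noteq> 0"
    show "\<exists>s. c = of_nat ?q ^ s"
    proof (rule disjoint_sum_eigenvalue[where f = f and c = c, OF km(3) _ _ x])
      show "disjoint_sum m (disjoint_sum k f) W = c * f W" if "W \<in> ?K" for W
        using eig[OF that] unfolding sum_card_common_complements .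
    qed (use km in simp)
  qed auto
  obtain e where e: "\<And>c. c \<in> set es \<Longrightarrow> c = of_nat ?q ^ e c" using es by metis
  define S where "S = mset (map e es)"
  have "(\<Sum>x\<in>?K. kernel_power ?K ?N j x x) = (\<Sum>s\<in>#S. (?q ^ s) ^ j)" for j
  proof -
    \<comment> \<open>Both sides are natural numbers, so they may be compared in the complex
      numbers, where the eigenvalues live.\<close>
    have "(of_nat (\<Sum>x\<in>?K. kernel_power ?K ?N j x x) :: complex) = (\<Sum>c\<leftarrow>es. c ^ j)"
      by (simp add: of_nat_kernel_power trace)
    also have "\<dots> = (\<Sum>c\<leftarrow>es. of_nat ((?q ^ e c) ^ j))"
      using e by (intro arg_cong[where f = sum_list] map_cong refl) (metis of_nat_power)
    also have "\<dots> = of_nat (\<Sum>s\<in>#S. (?q ^ s) ^ j)"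
      unfolding S_def mset_map[symmetric] sum_mset_sum_list by (induction es) simp_all
    finally show ?thesis by (simp only: of_nat_eq_iff)
  qed
  then have "1 / cycle_zeta ?G = (\<Prod>s\<in>#S. 1 - fps_const (of_nat ?q ^ s) * fps_X ^ 2)"
    by (intro inverse_cycle_zeta) (simp only: closed_walk_count_complement_graph_dim[OF km])
  then show thesis by (rule that)
qed

theorem theorem7p1p1:
  fixes q n k :: nat
  assumes "primepow q"
    and "CARD('a::{field,finite}) = q"
    and "CARD('n::finite) = n"
    and "n \<ge> 2"
    and "1 \<le> k" and "k \<le> n - 1"
    and "2 * k \<noteq> n"
  shows "\<exists>S :: nat multiset.
           1 / cycle_zeta (complement_graph_dim k ::
                 (('a^'n) set, ('a^'n) set \<times> ('a^'n) set) pre_digraph) =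
           (\<Prod>s\<in>#S. 1 - fps_const (of_nat q ^ s) * fps_X ^ 2)"
proof (cases "2 * k < n")
  case True
  then have "0 < k" "k < n - k" "k + (n - k) = CARD('n)" using assms by auto
  then show ?thesis
    using inverse_cycle_zeta_complement_graph_dim[where 'a = 'a and 'n = 'n] assms(2) by metis
next
  case False
  then have "0 < n - k" "n - k < k" "n - k + k = CARD('n)" using assms by auto
  then obtain S :: "nat multiset" where
    "1 / cycle_zeta (complement_graph_dim (n - k) :: (('a^'n) set, ('a^'n) set \<times> ('a^'n) set) pre_digraph)
      = (\<Prod>s\<in>#S. 1 - fps_const (of_nat CARD('a) ^ s) * fps_X ^ 2)"
    using inverse_cycle_zeta_complement_graph_dim[where 'a = 'a and 'n = 'n] by metis
  moreover have "complement_graph_dim (n - k) =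
      (complement_graph_dim k :: (('a^'n) set, ('a^'n) set \<times> ('a^'n) set) pre_digraph)"
    using complement_graph_dim_diff[where 'a = 'a and 'n = 'n, of k] assms by simp
  ultimately show ?thesis using assms(2) by auto
qed

end
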